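(* Assume that the following conditions hold. (1) $\mu\mapsto q_{ij}(\mu)$ is continuous on $\mathcal P(U)$ for every $i,j\in\mathcal S$, and $M:=\sup_{i\in\mathcal S}\sup_{\mu\in\mathcal P(U)}q_i(\mu)<\infty$. (2) There exist a compact function $\Phi:\mathcal S\to[1,\infty)$ (i.e. $\{i\in\mathcal S:\Phi(i)\le c\}$ is compact for every $c\in\mathbb R$), a compact set $B_0\subset\mathcal S$, and constants $\lambda_0>0$, $\kappa_0\ge 0$ such that for all $i\in\mathcal S$, $\mu\in\mathcal P(U)$, $\sum_{j\ne i}q_{ij}(\mu)(\Phi(j)-\Phi(i))\le\lambda_0\Phi(i)+\kappa_0\mathbf 1_{B_0}(i)$. (3) There exists $K\in\mathbb N$ such that for every $i\in\mathcal S$ and $\mu\in\mathcal P(U)$, $q_{ij}(\mu)=0$ whenever $|j-i|>K$. (4) $f$ and $g$ are bounded, and there is a constant $C_0$ such that $|f(t,i,\mu)-f(s,i,\mu)|\le C_0|t-s|$ for all $s,t\in[0,T]$, $i\in\mathcal S$, $\mu\in\mathcal P(U)$. Let $V_1$ (resp. $V_2$) be a viscosity supersolution (resp. viscosity subsolution) in $[0,T)\times\mathcal S$ of the HJB equation $$-\frac{\partial v}{\partial t}(t,i)-\inf_{\mu\in\mathcal P(U)}\Big\{\sum_{j\ne i}q_{ij}(\mu)\big(v(t,j)-v(t,i)\big)+f(t,i,\mu)\Big\}=0,\qquad v(T,i)=g(i).$$ Then $$\sup_{[0,T]\times\mathcal S}[V_2-V_1]=\sup_{\{T\}\times\mathcal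 S}[V_2-V_1]=0.$$
   Context: Fix $T>0$. $\mathcal S=\{1,2,\dots\}$ is the state space with the discrete topology; $U\subset\mathbb R^k$ is compact; $\mathcal P(U)$ is the space of probability measures on $U$ with the $L_1$-Wasserstein distance $W_1$ (equivalently, the weak topology). For each $\mu\in\mathcal P(U)$, $(q_{ij}(\mu))_{i,j\in\mathcal S}$ is a conservative transition rate matrix: $\sum_{j\ne i}q_{ij}(\mu)=q_i(\mu)=-q_{ii}(\mu)$ for all $i$. $f:[0,T]\times\mathcal S\times\mathcal P(U)\to[0,\infty)$ and $g:\mathcal S\to[0,\infty)$ are lower semi-continuous. Viscosity solutions. Let $v:[0,T]\times\mathcal S\to\mathbb R$ be continuous. $v$ is a viscosity supersolution (resp. subsolution) of the HJB equation if $v(T,i)=g(i)$ for all $i\in\mathcal S$ and $$-\frac{\partial\phi}{\partial t}(t_0,i_0)-\inf_{\mu\in\mathcal P(U)}\Big\{\sum_{j\ne i_0}q_{i_0j}(\mu)\big(\phi(t_0,j)-\phi(t_0,i_0)\big)+f(t_0,i_0,\mu)\Big\}\ge0\quad(\text{resp. }\le0)$$ for all $(t_0,i_0)\in[0,T)\times\mathcal S$ and all $\phi\in C^1([0,T)\times\mathcal S)$ (i.e. $\phi(\cdot,i)\in C^1([0,T))$ for each $i$) such that $(t_0,i_0)$ is a minimum (resp. maximum) point of $v-\phi$ over $[0,T)\times\mathcal S$.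
   Formalization: The formal statement additionally assumes that V_2 - V_1 is bounded above on [0,T]×S (without it the claim fails, e.g. for a pure birth chain with f = g = 0 and V_1 = 0), and that U is nonempty. *)

theory Defs
  imports "HOL-Probability.Probability"
begin

definition states :: "nat set" where
  "states = {1..}"

definition lower_semicontinuous :: "'a topology \<Rightarrow> ('a \<Rightarrow> real) \<Rightarrow> bool" where
  "lower_semicontinuous X h \<longleftrightarrow> (\<forall>a. closedin X {x \<in> topspace X. h x \<le> a})"

definition prob_on :: "'a::euclidean_space set \<Rightarrow> 'a measure set" where
  "prob_on U = space (prob_algebra (restrict_space borel U))"

definition couplings :: "'a::euclidean_space set \<Rightarrow> 'a measure \<Rightarrow> 'a measure \<Rightarrow> ('a \<times> 'a) measure set" where
  "couplings U \<mu> \<nu> =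
    {\<pi> \<in> space (prob_algebra (restrict_space borel U \<Otimes>\<^sub>M restrict_space borel U)).
       distr \<pi> (restrict_space borel U) fst = \<mu> \<and> distr \<pi> (restrict_space borel U) snd = \<nu>}"

definition W1 :: "'a::euclidean_space set \<Rightarrow> 'a measure \<Rightarrow> 'a measure \<Rightarrow> real" where
  "W1 U \<mu> \<nu> = (INF \<pi>\<in>couplings U \<mu> \<nu>. \<integral>z. dist (fst z) (snd z) \<partial>\<pi>)"

definition W1_topology :: "'a::euclidean_space set \<Rightarrow> 'a measure topology" where
  "W1_topology U = topology (\<lambda>G. G \<subseteq> prob_on U \<and>
     (\<forall>\<mu>\<in>G. \<exists>r>0. \<forall>\<nu>\<in>prob_on U. W1 U \<mu> \<nu> < r \<longrightarrow> \<nu> \<in> G))"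

text \<open>The argument of \<^const>\<open>topology\<close> above is a topology without any appeal to the metric axioms.\<close>

lemma openin_W1_topology:
  "openin (W1_topology U) G \<longleftrightarrow> G \<subseteq> prob_on U \<and>
     (\<forall>\<mu>\<in>G. \<exists>r>0. \<forall>\<nu>\<in>prob_on U. W1 U \<mu> \<nu> < r \<longrightarrow> \<nu> \<in> G)"
proof -
  have "istopology (\<lambda>G. G \<subseteq> prob_on U \<and>
     (\<forall>\<mu>\<in>G. \<exists>r>0. \<forall>\<nu>\<in>prob_on U. W1 U \<mu> \<nu> < r \<longrightarrow> \<nu> \<in> G))" (is "istopology ?P")
    unfolding istopology_def
  proof (intro conjI allI impI)
    fix G H assume G: "?P G" and H: "?P H"
    show "G \<inter> H \<subseteq> prob_on U" using G by blast
    show "\<forall>\<mu>\<in>G \<inter> H. \<exists>r>0. \<forall>\<nu>\<in>prob_on U. W1 U \<mu> \<nu> < r \<longrightarrow> \<nu> \<in> G \<inter> H"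
    proof
      fix \<mu> assume "\<mu> \<in> G \<inter> H"
      then obtain r s where "r > 0" "s > 0"
        and "\<forall>\<nu>\<in>prob_on U. W1 U \<mu> \<nu> < r \<longrightarrow> \<nu> \<in> G" "\<forall>\<nu>\<in>prob_on U. W1 U \<mu> \<nu> < s \<longrightarrow> \<nu> \<in> H"
        using G H by blast
      then show "\<exists>r>0. \<forall>\<nu>\<in>prob_on U. W1 U \<mu> \<nu> < r \<longrightarrow> \<nu> \<in> G \<inter> H"
        by (intro exI[of _ "min r s"]) auto
    qed
  next
    fix \<K> assume K: "\<forall>K\<in>\<K>. ?P K"
    show "\<Union>\<K> \<subseteq> prob_on U" using K by blast
    show "\<forall>\<mu>\<in>\<Union>\<K>. \<exists>r>0. \<forall>\<nu>\<in>prob_on U. W1 U \<mu> \<nu> < r \<longrightarrow> \<nu> \<in> \<Union>\<K>"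
      using K by (meson UnionE UnionI)
  qed
  then show ?thesis
    by (simp add: W1_topology_def topology_inverse')
qed

lemma topspace_W1_topology [simp]: "topspace (W1_topology U) = prob_on U"
proof -
  have "openin (W1_topology U) (prob_on U)"
    unfolding openin_W1_topology by (auto intro: exI[of _ 1])
  moreover have "topspace (W1_topology U) \<subseteq> prob_on U"
    using openin_topspace[of "W1_topology U"] unfolding openin_W1_topology by blast
  ultimately show ?thesis
    using openin_subset by blast
qed

definition conservative_rates :: "'a::euclidean_space set \<Rightarrow> (nat \<Rightarrow> nat \<Rightarrow> 'a measure \<Rightarrow> real) \<Rightarrow> bool" where
  "conservative_rates U q \<longleftrightarrow>
     (\<forall>\<mu>\<in>prob_on U. \<forall>i\<in>states.
        (\<forall>j\<in>states - {i}. q i j \<mu> \<ge> 0) \<and>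
        ((\<lambda>j. q i j \<mu>) has_sum (- q i i \<mu>)) (states - {i}))"

definition generator :: "(nat \<Rightarrow> nat \<Rightarrow> 'a measure \<Rightarrow> real) \<Rightarrow> 'a measure \<Rightarrow> (nat \<Rightarrow> real) \<Rightarrow> nat \<Rightarrow> real" where
  "generator q \<mu> h i = (\<Sum>\<^sub>\<infinity>j\<in>states - {i}. q i j \<mu> * (h j - h i))"

text \<open>\<open>C1_with_deriv T \<phi> \<phi>'\<close>: \<open>\<phi>\<close> is in \<open>C\<^sup>1([0,T) \<times> \<S>)\<close> with time derivative \<open>\<phi>'\<close>, which is
  one-sided at time 0 and is determined by \<open>\<phi>\<close> on \<open>[0,T) \<times> \<S>\<close>.\<close>

definition C1_with_deriv :: "real \<Rightarrow> (real \<Rightarrow> nat \<Rightarrow> real) \<Rightarrow> (real \<Rightarrow> nat \<Rightarrow> real) \<Rightarrow> bool" where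
  "C1_with_deriv T \<phi> \<phi>' \<longleftrightarrow>
     (\<forall>i\<in>states.
        (\<forall>t\<in>{0..<T}. ((\<lambda>s. \<phi> s i) has_real_derivative \<phi>' t i) (at t within {0..<T})) \<and>
        continuous_on {0..<T} (\<lambda>t. \<phi>' t i))"

definition HJB_lhs :: "'a::euclidean_space set \<Rightarrow> (nat \<Rightarrow> nat \<Rightarrow> 'a measure \<Rightarrow> real) \<Rightarrow>
    (real \<Rightarrow> nat \<Rightarrow> 'a measure \<Rightarrow> real) \<Rightarrow> (real \<Rightarrow> nat \<Rightarrow> real) \<Rightarrow> (real \<Rightarrow> nat \<Rightarrow> real) \<Rightarrow>
    real \<Rightarrow> nat \<Rightarrow> real" where
  "HJB_lhs U q f \<phi> \<phi>' t i =
     - \<phi>' t i - (INF \<mu>\<in>prob_on U. generator q \<mu> (\<phi> t) i + f t i \<mu>)"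

definition continuous_time_state :: "real \<Rightarrow> (real \<Rightarrow> nat \<Rightarrow> real) \<Rightarrow> bool" where
  "continuous_time_state T v \<longleftrightarrow>
     continuous_map (prod_topology (top_of_set {0..T}) (discrete_topology states)) euclideanreal
       (\<lambda>(t, i). v t i)"

text \<open>Viscosity super- and subsolutions are subject to no growth condition. Comparison therefore needs
  an upper bound on the difference of the two: take \<open>f = g = 0\<close> and the pure birth rates
  \<open>q i (i + 1) = 1\<close>. Then 0 is a supersolution, and \<open>v t i = A i * exp (- 1 / (i * (T - t)))\<close>, extended
  by 0 to \<open>t = T\<close>, is a subsolution for suitable constants \<open>A i > 0\<close>, namely such that
  \<open>v t (i + 1) \<ge> v t i - \<partial>v t i / \<partial>t\<close>; it is positive before time \<open>T\<close>, and unbounded in \<open>i\<close>.\<close>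

definition viscosity_supersolution :: "real \<Rightarrow> 'a::euclidean_space set \<Rightarrow> (nat \<Rightarrow> nat \<Rightarrow> 'a measure \<Rightarrow> real) \<Rightarrow>
    (real \<Rightarrow> nat \<Rightarrow> 'a measure \<Rightarrow> real) \<Rightarrow> (nat \<Rightarrow> real) \<Rightarrow> (real \<Rightarrow> nat \<Rightarrow> real) \<Rightarrow> bool" where
  "viscosity_supersolution T U q f g v \<longleftrightarrow>
     continuous_time_state T v \<and>
     (\<forall>i\<in>states. v T i = g i) \<and>
     (\<forall>\<phi> \<phi>'. \<forall>t0\<in>{0..<T}. \<forall>i0\<in>states.
        C1_with_deriv T \<phi> \<phi>' \<longrightarrow>
        (\<forall>t\<in>{0..<T}. \<forall>i\<in>states. v t0 i0 - \<phi> t0 i0 \<le> v t i - \<phi> t i) \<longrightarrow>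
        HJB_lhs U q f \<phi> \<phi>' t0 i0 \<ge> 0)"

definition viscosity_subsolution :: "real \<Rightarrow> 'a::euclidean_space set \<Rightarrow> (nat \<Rightarrow> nat \<Rightarrow> 'a measure \<Rightarrow> real) \<Rightarrow>
    (real \<Rightarrow> nat \<Rightarrow> 'a measure \<Rightarrow> real) \<Rightarrow> (nat \<Rightarrow> real) \<Rightarrow> (real \<Rightarrow> nat \<Rightarrow> real) \<Rightarrow> bool" where
  "viscosity_subsolution T U q f g v \<longleftrightarrow>
     continuous_time_state T v \<and>
     (\<forall>i\<in>states. v T i = g i) \<and>
     (\<forall>\<phi> \<phi>'. \<forall>t0\<in>{0..<T}. \<forall>i0\<in>states.
        C1_with_deriv T \<phi> \<phi>' \<longrightarrow>
        (\<forall>t\<in>{0..<T}. \<forall>i\<in>states. v t i - \<phi> t i \<le> v t0 i0 - \<phi> t0 i0) \<longrightarrow>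
        HJB_lhs U q f \<phi> \<phi>' t0 i0 \<le> 0)"

end

(* Doubling of variables is not needed. A test function at (t0, i) may be chosen arbitrarily close
   to V2 (or V1) at all states other than i, so V2(., i) is a scalar viscosity subsolution of
   - w' = h(t), where h is the Hamiltonian evaluated at V2 itself; h is continuous by the finite
   range and the Lipschitz bound on f. Hence c > h(t0) gives V2(b, i) >= V2(t0, i) - c (b - t0) for b
   slightly above t0, and dually for V1. These right increments contradict a positive maximum of
   V2 - V1 - delta exp((Lambda + 1)(T - t)) Phi with Lambda = lam0 + kap0; the maximum is attained
   because V2 - V1 is bounded above and the sublevel sets of Phi are finite. *)

theory Submission
  imports Defs
begin

section \<open>Scalar functions of time: contact points and right increments\<close>

lemma continuous_time_stateD:
  assumes "continuous_time_state T v" "i \<in> states"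
  shows "continuous_on {0..T} (\<lambda>t. v t i)"
proof -
  have "continuous_map (top_of_set {0..T})
      (prod_topology (top_of_set {0..T}) (discrete_topology states)) (\<lambda>t. (t, i))"
    using assms(2) by (auto simp: continuous_map_pairwise o_def)
  from continuous_map_compose[OF this assms(1)[unfolded continuous_time_state_def]]
  show ?thesis by (simp add: o_def)
qed

text \<open>Squaring removes the kink of \<open>max (t - c) 0\<close>: at the corner the difference
  quotient is bounded by |h|. This one-sided parabola is the wall from which C^1 penalties are built
  below.\<close>

lemma DERIV_max_power2:
  fixes c t :: real
  shows "((\<lambda>t. (max (t - c) 0)\<^sup>2) has_real_derivative 2 * max (t - c) 0) (at t)"
proof (cases t c rule: linorder_cases)
  case less
  have "((\<lambda>t. 0 :: real) has_real_derivative 2 * max (t - c) 0) (at t)"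
    using less by (auto simp: max_def)
  then show ?thesis
    by (rule has_field_derivative_transform_within_open[where S="{..<c}"]) (use less in auto)
next
  case equal
  have "((\<lambda>h. (max h 0)\<^sup>2 / h) \<longlongrightarrow> 0) (at (0::real))"
  proof (rule Lim_null_comparison)
    show "\<forall>\<^sub>F h in at (0::real). norm ((max h 0)\<^sup>2 / h) \<le> \<bar>h\<bar>"
      by (intro always_eventually) (auto simp: max_def power2_eq_square)
    show "((\<lambda>h. \<bar>h\<bar>) \<longlongrightarrow> 0) (at (0::real))"
      by (rule tendsto_rabs_zero) simp
  qed
  then show ?thesis
    using equal by (simp add: DERIV_def)
next
  case greater
  have "((\<lambda>t. (t - c)\<^sup>2) has_real_derivative 2 * max (t - c) 0) (at t)"
    using greater by (auto intro!: derivative_eq_intros)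
  then show ?thesis
    by (rule has_field_derivative_transform_within_open[where S="{c<..}"]) (use greater in auto)
qed

text \<open>Quadratic walls outside \<open>[t0,b]\<close> make the contact global on \<open>[0,T)\<close>.\<close>

lemma touching_test_function:
  fixes u :: "real \<Rightarrow> real"
  assumes cont: "continuous_on {0..T} u" and t0: "0 \<le> t0" and b: "t0 < b" "b < T" "b < t0 + r"
    and dec: "u b < u t0"
  obtains \<theta> \<theta>' s where "\<And>t. (\<theta> has_real_derivative \<theta>' t) (at t)" "continuous_on UNIV \<theta>'"
    "s \<in> {0..<T}" "\<bar>s - t0\<bar> < r" "\<theta>' s \<le> 0"
    "\<And>t. t \<in> {0..<T} \<Longrightarrow> u t - \<theta> t \<le> u s - \<theta> s"
proof -
  obtain e where e: "e > 0" "\<And>t. t \<in> {0..T} \<Longrightarrow> \<bar>t - b\<bar> < e \<Longrightarrow> u t < u t0"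
  proof -
    from cont b t0 have "continuous (at b within {0..T}) u"
      by (auto simp: continuous_on_eq_continuous_within)
    then obtain e where "e > 0" "\<And>t. t \<in> {0..T} \<Longrightarrow> dist t b < e \<Longrightarrow> dist (u t) (u b) < u t0 - u b"
      using dec unfolding continuous_within_eps_delta by (metis diff_gt_0_iff_gt)
    then show ?thesis by (intro that[of e]) (force simp: dist_real_def)+
  qed
  obtain B where "\<forall>t\<in>{0..T}. \<bar>u t\<bar> \<le> B"
    using compact_imp_bounded[OF compact_continuous_image[OF cont compact_Icc]]
    unfolding bounded_iff by auto
  then have B: "\<bar>u t\<bar> \<le> B" if "t \<in> {0..T}" for t using that by blast
  \<comment> \<open>Within \<open>d\<close> of \<open>b\<close> the function stays below
    \<open>u t0\<close>, and going left of \<open>t0\<close> by less than \<open>d\<close> stays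
    within radius \<open>r\<close>.\<close>
  define d where "d = Min {e, r, T - b}"
  have d: "d > 0" "d \<le> e" "d \<le> r" "d \<le> T - b" using e b by (auto simp: d_def)
  have B0: "B \<ge> 0" using B[of t0] t0 b by force
  \<comment> \<open>The oscillation of \<open>u\<close> is at most \<open>2 * B\<close>, so a wall
    that reaches height \<open>2 * B + 1\<close> at distance \<open>d\<close> excludes a maximum at
    that distance or beyond.\<close>
  define A where "A = (2 * B + 1) / d\<^sup>2"
  have A: "A > 0" and Ad: "A * d\<^sup>2 = 2 * B + 1" using d B0 by (auto simp: A_def)
  have wall: "2 * B < A * x\<^sup>2" if "d \<le> x" for x
  proof -
    have "A * d\<^sup>2 \<le> A * x\<^sup>2" using A that d by simp
    then show ?thesis using Ad by linarith
  qed
  \<comment> \<open>The penalty vanishes on [t0,b]. Its left wall is the right wall reflected, hence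
    the argument \<open>- t\<close>.\<close>
  define \<theta> where "\<theta> t = A * (max (- t - (- t0)) 0)\<^sup>2 + A * (max (t - b) 0)\<^sup>2" for t
  define \<theta>' where "\<theta>' t = - (A * (2 * max (- t - (- t0)) 0)) + A * (2 * max (t - b) 0)" for t
  have deriv: "(\<theta> has_real_derivative \<theta>' t) (at t)" for t
  proof -
    have "((\<lambda>t. (max (- t - (- t0)) 0)\<^sup>2) has_real_derivative 2 * max (- t - (- t0)) 0 * - 1) (at t)"
      by (rule DERIV_chain2[where f = "\<lambda>x. (max (x - (- t0)) 0)\<^sup>2" and g = uminus])
        (rule DERIV_max_power2, auto intro!: derivative_eq_intros)
    from DERIV_add[OF DERIV_cmult[OF this, of A] DERIV_cmult[OF DERIV_max_power2[of b t], of A]]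
    show ?thesis by (simp add: \<theta>_def[abs_def] \<theta>'_def)
  qed
  have cont': "continuous_on UNIV \<theta>'"
    unfolding \<theta>'_def by (intro continuous_intros)
  have "continuous_on {0..T} (\<lambda>t. u t - \<theta> t)"
    using cont DERIV_continuous_on[of "{0..T}" \<theta> \<theta>'] deriv
    by (intro continuous_intros) (auto intro: has_field_derivative_at_within)
  then obtain s where s: "s \<in> {0..T}" and smax: "\<And>t. t \<in> {0..T} \<Longrightarrow> u t - \<theta> t \<le> u s - \<theta> s"
    using continuous_attains_sup[OF compact_Icc, of 0 T "\<lambda>t. u t - \<theta> t"] t0 b by force
  have th0: "\<theta> t0 = 0" using b by (simp add: \<theta>_def)
  have th_nonneg: "\<theta> t \<ge> 0" for t using A by (simp add: \<theta>_def)
  have at_s: "u t0 \<le> u s - \<theta> s" using smax[of t0] th0 t0 b by auto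
  then have th_le: "\<theta> s \<le> 2 * B" using B[of s] B[of t0] s t0 b by force
  have s1: "s > t0 - d"
  proof (rule ccontr)
    assume "\<not> s > t0 - d"
    then have "2 * B < A * (max (- s - (- t0)) 0)\<^sup>2" using wall[of "t0 - s"] d by auto
    also have "\<dots> \<le> \<theta> s" using A by (simp add: \<theta>_def)
    finally show False using th_le by simp
  qed
  have s2: "s < b + d"
  proof (rule ccontr)
    assume "\<not> s < b + d"
    then have "2 * B < A * (max (s - b) 0)\<^sup>2" using wall[of "s - b"] d by auto
    also have "\<dots> \<le> \<theta> s" using A by (simp add: \<theta>_def)
    finally show False using th_le by simp
  qed
  \<comment> \<open>A maximum at or beyond \<open>b\<close> would be beaten by \<open>t0\<close>,
    where the penalty is zero. Left of \<open>b\<close> at most the left wall is active, so the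
    penalty has nonpositive slope at \<open>s\<close>.\<close>
  have s3: "s < b"
  proof (rule ccontr)
    assume "\<not> s < b"
    then have "u s < u t0" using e(2)[OF s] s2 d by auto
    then show False using at_s th_nonneg[of s] by simp
  qed
  show ?thesis
  proof (rule that[OF deriv cont', of s])
    show "s \<in> {0..<T}" using s s3 b by auto
    show "\<bar>s - t0\<bar> < r" using s1 s3 b d by auto
    show "\<theta>' s \<le> 0" using s3 A by (auto simp: \<theta>'_def)
    show "u t - \<theta> t \<le> u s - \<theta> s" if "t \<in> {0..<T}" for t using smax[of t] that by auto
  qed
qed

text \<open>If the bound fails at \<open>b\<close>, the tilted function u(t) + c (t - t0) drops
  strictly from \<open>t0\<close> to \<open>b\<close>, so some penalty touches it near
  \<open>t0\<close> at a point \<open>s\<close> where the slope of the penalty is at most 0. With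
  the tilt removed, the viscosity inequality yields c \<le> h(s), although continuity keeps
  \<open>h\<close> below \<open>c\<close> near \<open>t0\<close>.\<close>

lemma viscosity_right_increment:
  fixes u h :: "real \<Rightarrow> real"
  assumes cont: "continuous_on {0..T} u" and t0: "t0 \<in> {0..<T}"
    and h: "continuous (at t0 within {0..<T}) h" and c: "h t0 < c"
    and visc: "\<And>\<theta> \<theta>' s. (\<And>t. (\<theta> has_real_derivative \<theta>' t) (at t)) \<Longrightarrow> continuous_on UNIV \<theta>' \<Longrightarrow>
       s \<in> {0..<T} \<Longrightarrow> (\<And>t. t \<in> {0..<T} \<Longrightarrow> u t - \<theta> t \<le> u s - \<theta> s) \<Longrightarrow> - \<theta>' s \<le> h s"
  shows "\<forall>\<^sub>F b in at_right t0. u b \<ge> u t0 - c * (b - t0)"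
proof -
  obtain r where r: "r > 0" "\<And>s. s \<in> {0..<T} \<Longrightarrow> \<bar>s - t0\<bar> < r \<Longrightarrow> h s < c"
  proof -
    from h c obtain r where "r > 0" "\<And>s. s \<in> {0..<T} \<Longrightarrow> dist s t0 < r \<Longrightarrow> dist (h s) (h t0) < c - h t0"
      unfolding continuous_within_eps_delta by (metis diff_gt_0_iff_gt)
    then show ?thesis by (intro that[of r]) (force simp: dist_real_def)+
  qed
  have "u b \<ge> u t0 - c * (b - t0)" if b: "b \<in> {t0<..<min T (t0 + r)}" for b
  proof (rule ccontr)
    assume "\<not> ?thesis"
    then have dec: "u b + c * (b - t0) < u t0 + c * (t0 - t0)" by simp
    have contc: "continuous_on {0..T} (\<lambda>t. u t + c * (t - t0))"
      by (intro continuous_intros cont)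
    obtain \<theta> \<theta>' s where \<theta>: "\<And>t. (\<theta> has_real_derivative \<theta>' t) (at t)" "continuous_on UNIV \<theta>'"
      "s \<in> {0..<T}" "\<bar>s - t0\<bar> < r" "\<theta>' s \<le> 0"
      "\<And>t. t \<in> {0..<T} \<Longrightarrow> u t + c * (t - t0) - \<theta> t \<le> u s + c * (s - t0) - \<theta> s"
      using touching_test_function[OF contc _ _ _ _ dec, of r] t0 b by auto
    have "- (\<theta>' s - c) \<le> h s"
    proof (rule visc[of "\<lambda>t. \<theta> t - c * (t - t0)" "\<lambda>t. \<theta>' t - c" s])
      show "((\<lambda>t. \<theta> t - c * (t - t0)) has_real_derivative \<theta>' t - c) (at t)" for t
        by (auto intro!: derivative_eq_intros \<theta>(1))
      show "continuous_on UNIV (\<lambda>t. \<theta>' t - c)" by (intro continuous_intros \<theta>(2))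
      show "u t - (\<theta> t - c * (t - t0)) \<le> u s - (\<theta> s - c * (s - t0))" if "t \<in> {0..<T}" for t
        using \<theta>(6)[OF that] by simp
    qed (use \<theta> in auto)
    then show False using r(2)[of s] \<theta> by simp
  qed
  then show ?thesis
    using r t0 by (intro eventually_at_rightI[of t0 "min T (t0 + r)"]) auto
qed

text \<open>Continuity gives the bound near \<open>t0\<close>; at distance \<open>r\<close> or more
  a parabola of height \<open>2 * B\<close> at distance \<open>r\<close> absorbs the whole
  oscillation. Such parabolas let a smooth function of time stay on one side of a merely continuous
  one while being \<epsilon>-close to it at \<open>t0\<close>.\<close>

lemma quadratic_majorant:
  fixes w :: "real \<Rightarrow> real"
  assumes cont: "continuous_on {0..T} w" and t0: "t0 \<in> {0..T}" and eps: "\<epsilon> > 0"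
  obtains C where "\<And>t. t \<in> {0..T} \<Longrightarrow> \<bar>w t - w t0\<bar> \<le> \<epsilon> + C * (t - t0)\<^sup>2"
proof -
  from cont t0 have "continuous (at t0 within {0..T}) w"
    by (auto simp: continuous_on_eq_continuous_within)
  then obtain r where r: "r > 0" "\<And>t. t \<in> {0..T} \<Longrightarrow> dist t t0 < r \<Longrightarrow> dist (w t) (w t0) < \<epsilon>"
    using eps unfolding continuous_within_eps_delta by metis
  obtain B where "\<forall>t\<in>{0..T}. \<bar>w t\<bar> \<le> B"
    using compact_imp_bounded[OF compact_continuous_image[OF cont compact_Icc]]
    unfolding bounded_iff by auto
  then have B: "\<bar>w t\<bar> \<le> B" if "t \<in> {0..T}" for t using that by blast
  have B0: "B \<ge> 0" using B[OF t0] by linarith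
  show ?thesis
  proof (rule that[of "2 * B / r\<^sup>2"])
    fix t assume t: "t \<in> {0..T}"
    show "\<bar>w t - w t0\<bar> \<le> \<epsilon> + 2 * B / r\<^sup>2 * (t - t0)\<^sup>2"
    proof (cases "dist t t0 < r")
      case True
      have "0 \<le> 2 * B / r\<^sup>2 * (t - t0)\<^sup>2" using B0 by simp
      then show ?thesis using r(2)[OF t True] by (simp add: dist_real_def)
    next
      case False
      then have "r\<^sup>2 \<le> (t - t0)\<^sup>2"
        using r(1) by (metis abs_le_square_iff abs_of_pos dist_real_def not_less)
      then have "2 * B * 1 \<le> 2 * B * ((t - t0)\<^sup>2 / r\<^sup>2)"
        using B0 r(1) by (intro mult_left_mono) (auto simp: divide_simps)
      then show ?thesis using B[OF t] B[OF t0] eps by (auto simp: field_simps)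
    qed
  qed
qed

lemma le_if_le_add_eps_mult:
  fixes x y c :: real
  assumes "\<And>\<epsilon>. \<epsilon> > 0 \<Longrightarrow> x \<le> y + \<epsilon> * c" and "c \<ge> 0"
  shows "x \<le> y"
proof (rule field_le_epsilon)
  fix e :: real assume "e > 0"
  \<comment> \<open>The denominator \<open>c + 1\<close> covers the case
    \<open>c = 0\<close>.\<close>
  have "e / (c + 1) * c \<le> e" using assms(2) \<open>e > 0\<close> by (simp add: divide_simps)
  moreover have "x \<le> y + e / (c + 1) * c" using assms \<open>e > 0\<close> by (intro assms(1)) auto
  ultimately show "x \<le> y + e" by linarith
qed

section \<open>Test functions and the Hamiltonian\<close>

text \<open>Only state \<open>i\<close> carries the free curve \<theta>. At time \<open>r\<close>
  the values are exactly \<open>A\<close>, whatever \<theta> and \<open>C\<close> are, because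
  \<theta> is shifted and the parabolas have their vertex at \<open>r\<close>. The generator at the
  contact time therefore sees \<open>A\<close> alone.\<close>

definition test_function :: "nat \<Rightarrow> (real \<Rightarrow> real) \<Rightarrow> (nat \<Rightarrow> real) \<Rightarrow> (nat \<Rightarrow> real) \<Rightarrow> real \<Rightarrow> real \<Rightarrow> nat \<Rightarrow> real" where
  "test_function i \<theta> A C r t j = (if j = i then \<theta> t - \<theta> r + A i else A j + C j * (t - r)\<^sup>2)"

lemma test_function_C1:
  assumes "\<And>t. (\<theta> has_real_derivative \<theta>' t) (at t)" "continuous_on UNIV \<theta>'"
  shows "C1_with_deriv T (test_function i \<theta> A C r) (\<lambda>t j. if j = i then \<theta>' t else C j * (2 * (t - r)))"
  unfolding C1_with_deriv_def test_function_def
proof (intro ballI conjI)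
  fix j t
  show "((\<lambda>s. if j = i then \<theta> s - \<theta> r + A i else A j + C j * (s - r)\<^sup>2) has_real_derivative
      (if j = i then \<theta>' t else C j * (2 * (t - r)))) (at t within {0..<T})"
    by (auto intro!: derivative_eq_intros has_field_derivative_at_within[OF assms(1)])
next
  fix j
  show "continuous_on {0..<T} (\<lambda>t. if j = i then \<theta>' t else C j * (2 * (t - r)))"
    by (cases "j = i") (auto intro!: continuous_intros continuous_on_subset[OF assms(2)])
qed

text \<open>The infimum in \<open>HJB_lhs\<close>, detached from test functions so that it can be
  evaluated at the viscosity solutions themselves.\<close>

definition hamiltonian :: "'a::euclidean_space set \<Rightarrow> (nat \<Rightarrow> nat \<Rightarrow> 'a measure \<Rightarrow> real) \<Rightarrow>
    (real \<Rightarrow> nat \<Rightarrow> 'a measure \<Rightarrow> real) \<Rightarrow> (nat \<Rightarrow> real) \<Rightarrow> real \<Rightarrow> nat \<Rightarrow> real" where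
  "hamiltonian U q f h t i = (INF \<mu>\<in>prob_on U. generator q \<mu> h i + f t i \<mu>)"

section \<open>Generator and Hamiltonian for rates of finite range\<close>

locale finite_range_control =
  fixes T :: real
    and U :: "'a::euclidean_space set"
    and q :: "nat \<Rightarrow> nat \<Rightarrow> 'a measure \<Rightarrow> real"
    and f :: "real \<Rightarrow> nat \<Rightarrow> 'a measure \<Rightarrow> real"
    and M C0 :: real
    and K :: nat
  assumes U_nonempty: "U \<noteq> {}"
    and q_conservative: "conservative_rates U q"
    and f_nonneg: "\<lbrakk>t \<in> {0..T}; i \<in> states; \<mu> \<in> prob_on U\<rbrakk> \<Longrightarrow> f t i \<mu> \<ge> 0"
    and q_diag_le: "\<lbrakk>i \<in> states; \<mu> \<in> prob_on U\<rbrakk> \<Longrightarrow> - q i i \<mu> \<le> M"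
    and finite_range: "\<lbrakk>i \<in> states; j \<in> states; \<mu> \<in> prob_on U; \<bar>int j - int i\<bar> > int K\<rbrakk> \<Longrightarrow> q i j \<mu> = 0"
    and f_lipschitz: "\<lbrakk>s \<in> {0..T}; t \<in> {0..T}; i \<in> states; \<mu> \<in> prob_on U\<rbrakk> \<Longrightarrow>
        \<bar>f t i \<mu> - f s i \<mu>\<bar> \<le> C0 * \<bar>t - s\<bar>"
begin

definition nbrs :: "nat \<Rightarrow> nat set" where
  "nbrs i = {j \<in> states - {i}. \<bar>int j - int i\<bar> \<le> int K}"

lemma finite_nbrs [simp]: "finite (nbrs i)"
  by (rule finite_subset[of _ "{..i + K}"]) (auto simp: nbrs_def)

lemma nbrs_states: "j \<in> nbrs i \<Longrightarrow> j \<in> states"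
  by (auto simp: nbrs_def)

text \<open>A Dirac measure at a point of \<open>U\<close>. Lower bounds pass to the infimum over
  controls only if there is a control.\<close>

lemma prob_on_nonempty: "prob_on U \<noteq> {}"
proof -
  obtain x where "x \<in> U" using U_nonempty by blast
  then have "return (restrict_space borel U) x \<in> prob_on U"
    by (auto simp: prob_on_def space_prob_algebra space_restrict_space intro!: prob_space_return)
  then show ?thesis by blast
qed

lemma q_bounds:
  assumes "\<mu> \<in> prob_on U" "i \<in> states" "j \<in> nbrs i"
  shows "0 \<le> q i j \<mu>" "q i j \<mu> \<le> M"
proof -
  have nn: "\<And>j. j \<in> states - {i} \<Longrightarrow> q i j \<mu> \<ge> 0"
    and hs: "((\<lambda>j. q i j \<mu>) has_sum (- q i i \<mu>)) (states - {i})"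
    using q_conservative assms unfolding conservative_rates_def by blast+
  have j: "j \<in> states - {i}" using assms by (simp add: nbrs_def)
  show "0 \<le> q i j \<mu>" using nn[OF j] .
  have "sum (\<lambda>j. q i j \<mu>) {j} \<le> - q i i \<mu>"
    by (rule finite_sum_le_has_sum[OF hs]) (use j nn in auto)
  then show "q i j \<mu> \<le> M" using q_diag_le[OF assms(2,1)] by simp
qed

text \<open>Rates beyond distance \<open>K\<close> vanish, so summability is never an issue and the
  generator acts linearly on arbitrary functions.\<close>

lemma generator_eq_sum:
  assumes "\<mu> \<in> prob_on U" "i \<in> states"
  shows "generator q \<mu> h i = (\<Sum>j\<in>nbrs i. q i j \<mu> * (h j - h i))"
proof -
  have "generator q \<mu> h i = (\<Sum>\<^sub>\<infinity>j\<in>nbrs i. q i j \<mu> * (h j - h i))"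
    unfolding generator_def
    by (rule infsum_cong_neutral) (use assms finite_range[of i _ \<mu>] in \<open>auto simp: nbrs_def not_le\<close>)
  then show ?thesis by simp
qed

text \<open>Each single rate lies between 0 and \<open>M\<close>, so the error term is independent
  of the control and survives taking the infimum.\<close>

lemma generator_le:
  assumes "\<mu> \<in> prob_on U" "i \<in> states"
  shows "generator q \<mu> a i \<le> generator q \<mu> b i + (\<Sum>j\<in>nbrs i. M * \<bar>(a j - a i) - (b j - b i)\<bar>)"
proof -
  have "q i j \<mu> * (a j - a i) \<le> q i j \<mu> * (b j - b i) + M * \<bar>(a j - a i) - (b j - b i)\<bar>"
    if "j \<in> nbrs i" for j
  proof -
    have "q i j \<mu> * ((a j - a i) - (b j - b i)) \<le> q i j \<mu> * \<bar>(a j - a i) - (b j - b i)\<bar>"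
      using q_bounds[OF assms that] by (intro mult_left_mono) auto
    also have "\<dots> \<le> M * \<bar>(a j - a i) - (b j - b i)\<bar>"
      using q_bounds[OF assms that] by (intro mult_right_mono) auto
    finally show ?thesis by (simp add: algebra_simps)
  qed
  then have "(\<Sum>j\<in>nbrs i. q i j \<mu> * (a j - a i)) \<le>
      (\<Sum>j\<in>nbrs i. q i j \<mu> * (b j - b i) + M * \<bar>(a j - a i) - (b j - b i)\<bar>)"
    by (rule sum_mono)
  then show ?thesis
    by (simp add: generator_eq_sum[OF assms] sum.distrib)
qed

text \<open>The generator of the zero function is 0 and \<open>f\<close> is nonnegative, so
  \<open>generator_le\<close> bounds the expression from below. This makes the real-valued
  \<open>INF\<close> a genuine infimum.\<close>

lemma hamiltonian_bdd_below:
  assumes "i \<in> states" "t \<in> {0..T}"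
  shows "bdd_below ((\<lambda>\<mu>. generator q \<mu> h i + f t i \<mu>) ` prob_on U)"
proof (rule bdd_belowI2)
  fix \<mu> assume \<mu>: "\<mu> \<in> prob_on U"
  have "generator q \<mu> (\<lambda>_. 0) i = 0" by (simp add: generator_def)
  then show "- (\<Sum>j\<in>nbrs i. M * \<bar>(0 - 0) - (h j - h i)\<bar>) \<le> generator q \<mu> h i + f t i \<mu>"
    using generator_le[OF \<mu> assms(1), of "\<lambda>_. 0" h] f_nonneg[OF assms(2,1) \<mu>] by simp
qed

lemma hamiltonian_mono:
  assumes i: "i \<in> states" and t: "t \<in> {0..T}"
    and le: "\<And>\<mu>. \<mu> \<in> prob_on U \<Longrightarrow> generator q \<mu> a i + f t i \<mu> \<le> generator q \<mu> b i + f s i \<mu> + c"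
  shows "hamiltonian U q f a t i \<le> hamiltonian U q f b s i + c"
proof -
  have "hamiltonian U q f a t i - c \<le> hamiltonian U q f b s i"
    unfolding hamiltonian_def
  proof (rule cINF_greatest[OF prob_on_nonempty])
    fix \<mu> assume \<mu>: "\<mu> \<in> prob_on U"
    have "(INF \<mu>\<in>prob_on U. generator q \<mu> a i + f t i \<mu>) \<le> generator q \<mu> a i + f t i \<mu>"
      by (rule cINF_lower[OF hamiltonian_bdd_below[OF i t] \<mu>])
    then show "(INF \<mu>\<in>prob_on U. generator q \<mu> a i + f t i \<mu>) - c \<le> generator q \<mu> b i + f s i \<mu>"
      using le[OF \<mu>] by linarith
  qed
  then show ?thesis by simp
qed

lemma hamiltonian_le:
  assumes i: "i \<in> states" and t: "t \<in> {0..T}" and s: "s \<in> {0..T}"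
  shows "hamiltonian U q f a t i \<le> hamiltonian U q f b s i +
    ((\<Sum>j\<in>nbrs i. M * \<bar>(a j - a i) - (b j - b i)\<bar>) + C0 * \<bar>t - s\<bar>)"
proof (rule hamiltonian_mono[OF i t])
  fix \<mu> assume \<mu>: "\<mu> \<in> prob_on U"
  show "generator q \<mu> a i + f t i \<mu> \<le> generator q \<mu> b i + f s i \<mu> +
    ((\<Sum>j\<in>nbrs i. M * \<bar>(a j - a i) - (b j - b i)\<bar>) + C0 * \<bar>t - s\<bar>)"
    using generator_le[OF \<mu> i, of a b] f_lipschitz[OF s t i \<mu>] by linarith
qed

text \<open>The error in \<open>hamiltonian_le\<close> is a finite sum over neighbours plus a
  Lipschitz term; continuity of each \<open>v\<close> in time, state by state, sends it to 0. Using
  the estimate in both directions gives the absolute value.\<close>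

lemma hamiltonian_continuous:
  assumes v: "\<And>i. i \<in> states \<Longrightarrow> continuous_on {0..T} (\<lambda>t. v t i)"
    and i: "i \<in> states" and t0: "t0 \<in> {0..<T}"
  shows "continuous (at t0 within {0..<T}) (\<lambda>t. hamiltonian U q f (v t) t i)"
proof -
  let ?E = "\<lambda>t. (\<Sum>j\<in>nbrs i. M * \<bar>(v t j - v t i) - (v t0 j - v t0 i)\<bar>) + C0 * \<bar>t - t0\<bar>"
  have lim: "((\<lambda>t. v t j) \<longlongrightarrow> v t0 j) (at t0 within {0..<T})" if "j \<in> states" for j
    using v[OF that] t0 unfolding continuous_on_def
    by (meson atLeastLessThan_subseteq_atLeastAtMost_iff in_mono order_refl tendsto_within_subset)
  have "(?E \<longlongrightarrow> (\<Sum>j\<in>nbrs i. M * \<bar>(v t0 j - v t0 i) - (v t0 j - v t0 i)\<bar>) + C0 * \<bar>t0 - t0\<bar>)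
      (at t0 within {0..<T})"
    by (intro tendsto_intros lim i) (auto dest: nbrs_states)
  then have E0: "(?E \<longlongrightarrow> 0) (at t0 within {0..<T})" by simp
  have "\<bar>hamiltonian U q f (v t) t i - hamiltonian U q f (v t0) t0 i\<bar> \<le> ?E t" if "t \<in> {0..<T}" for t
    using hamiltonian_le[OF i, of t t0 "v t" "v t0"] hamiltonian_le[OF i, of t0 t "v t0" "v t"] that t0
    by (simp add: abs_minus_commute abs_le_iff)
  then have "((\<lambda>t. hamiltonian U q f (v t) t i - hamiltonian U q f (v t0) t0 i) \<longlongrightarrow> 0) (at t0 within {0..<T})"
    by (intro Lim_null_comparison[OF _ E0]) (auto simp: eventually_at_filter)
  then show ?thesis
    unfolding continuous_within by (simp add: LIM_zero_iff)
qed

text \<open>As the two functions agree at \<open>i\<close>, each increment from \<open>i\<close>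
  changes by at most \<epsilon>. Writing \<open>\<bar>M\<bar>\<close> makes the factor of \<epsilon>
  visibly nonnegative for the limit \<epsilon> \<rightarrow> 0.\<close>

lemma hamiltonian_perturb:
  assumes i: "i \<in> states" and t: "t \<in> {0..T}" and eps: "\<epsilon> \<ge> 0"
    and ai: "a i = b i" and ab: "\<And>j. \<bar>a j - b j\<bar> \<le> \<epsilon>"
  shows "hamiltonian U q f a t i \<le> hamiltonian U q f b t i + \<epsilon> * (card (nbrs i) * \<bar>M\<bar>)"
proof -
  have "M * \<bar>(a j - a i) - (b j - b i)\<bar> \<le> \<bar>M\<bar> * \<epsilon>" for j
    using ab[of j] ai by (intro mult_mono) auto
  then have "(\<Sum>j\<in>nbrs i. M * \<bar>(a j - a i) - (b j - b i)\<bar>) \<le> (\<Sum>j\<in>nbrs i. \<bar>M\<bar> * \<epsilon>)"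
    by (intro sum_mono)
  then show ?thesis
    using hamiltonian_le[OF i t t, of a b] by (simp add: mult_ac)
qed

section \<open>Viscosity inequalities at a single state\<close>

text \<open>A contact in time at the one state \<open>i\<close> is extended to a contact over all
  states by placing the test function above \<open>v\<close> elsewhere, with gap \<epsilon> at time
  \<open>s\<close>. The Hamiltonian of the test function then differs from that of \<open>v\<close>
  by a multiple of \<epsilon>, which tends to 0.\<close>

lemma subsolution_scalar:
  assumes sub: "viscosity_subsolution T U q f g v" and i: "i \<in> states" and s: "s \<in> {0..<T}"
    and \<theta>: "\<And>t. (\<theta> has_real_derivative \<theta>' t) (at t)" "continuous_on UNIV \<theta>'"
    and max: "\<And>t. t \<in> {0..<T} \<Longrightarrow> v t i - \<theta> t \<le> v s i - \<theta> s"
  shows "- \<theta>' s \<le> hamiltonian U q f (v s) s i"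
proof (rule le_if_le_add_eps_mult[of _ _ "card (nbrs i) * \<bar>M\<bar>"])
  fix \<epsilon> :: real assume eps: "\<epsilon> > 0"
  have cont: "continuous_on {0..T} (\<lambda>t. v t j)" if "j \<in> states" for j
    using sub that continuous_time_stateD unfolding viscosity_subsolution_def by blast
  have "\<exists>C. \<forall>t\<in>{0..T}. \<bar>v t j - v s j\<bar> \<le> \<epsilon> + C * (t - s)\<^sup>2" if "j \<in> states" for j
    using quadratic_majorant[OF cont[OF that] _ eps, of s] s by (metis atLeastLessThan_iff atLeastAtMost_iff less_imp_le)
  then obtain C where C: "\<And>j t. j \<in> states \<Longrightarrow> t \<in> {0..T} \<Longrightarrow> \<bar>v t j - v s j\<bar> \<le> \<epsilon> + C j * (t - s)\<^sup>2"
    by metis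
  \<comment> \<open>With this \<open>A\<close> the difference of \<open>v\<close> and the test
    function is 0 at the contact point, and the majorant makes it nonpositive at every other
    state.\<close>
  define A where "A j = (if j = i then v s i else v s j + \<epsilon>)" for j
  let ?\<phi> = "test_function i \<theta> A C s"
  have \<phi>s: "?\<phi> s = A" by (auto simp: test_function_def fun_eq_iff)
  have "v t j - ?\<phi> t j \<le> v s i - ?\<phi> s i" if "t \<in> {0..<T}" "j \<in> states" for t j
  proof (cases "j = i")
    case True
    then show ?thesis using max[OF that(1)] by (simp add: test_function_def)
  next
    case False
    have "v t j - v s j \<le> \<epsilon> + C j * (t - s)\<^sup>2" using C[OF that(2), of t] that by auto
    then show ?thesis using False by (simp add: test_function_def A_def)
  qed
  with test_function_C1[OF \<theta>, where T = T and i = i and A = A and C = C and r = s] sub s i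
  have "HJB_lhs U q f ?\<phi> (\<lambda>t j. if j = i then \<theta>' t else C j * (2 * (t - s))) s i \<le> 0"
    unfolding viscosity_subsolution_def by blast
  then have "- \<theta>' s \<le> hamiltonian U q f A s i"
    by (simp add: HJB_lhs_def hamiltonian_def \<phi>s)
  also have "\<dots> \<le> hamiltonian U q f (v s) s i + \<epsilon> * (card (nbrs i) * \<bar>M\<bar>)"
    by (rule hamiltonian_perturb) (use s i eps in \<open>auto simp: A_def\<close>)
  finally show "- \<theta>' s \<le> hamiltonian U q f (v s) s i + \<epsilon> * (card (nbrs i) * \<bar>M\<bar>)" .
qed simp

text \<open>The mirror image: at the other states the test function lies below \<open>v\<close>,
  with downward parabolas and the offset \<open>- \<epsilon>\<close>.\<close>

lemma supersolution_scalar: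
  assumes super: "viscosity_supersolution T U q f g v" and i: "i \<in> states" and s: "s \<in> {0..<T}"
    and \<theta>: "\<And>t. (\<theta> has_real_derivative \<theta>' t) (at t)" "continuous_on UNIV \<theta>'"
    and min: "\<And>t. t \<in> {0..<T} \<Longrightarrow> v s i - \<theta> s \<le> v t i - \<theta> t"
  shows "hamiltonian U q f (v s) s i \<le> - \<theta>' s"
proof (rule le_if_le_add_eps_mult[of _ _ "card (nbrs i) * \<bar>M\<bar>"])
  fix \<epsilon> :: real assume eps: "\<epsilon> > 0"
  have cont: "continuous_on {0..T} (\<lambda>t. v t j)" if "j \<in> states" for j
    using super that continuous_time_stateD unfolding viscosity_supersolution_def by blast
  have "\<exists>C. \<forall>t\<in>{0..T}. \<bar>v t j - v s j\<bar> \<le> \<epsilon> + C * (t - s)\<^sup>2" if "j \<in> states" for j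
    using quadratic_majorant[OF cont[OF that] _ eps, of s] s by (metis atLeastLessThan_iff atLeastAtMost_iff less_imp_le)
  then obtain C where C: "\<And>j t. j \<in> states \<Longrightarrow> t \<in> {0..T} \<Longrightarrow> \<bar>v t j - v s j\<bar> \<le> \<epsilon> + C j * (t - s)\<^sup>2"
    by metis
  define A where "A j = (if j = i then v s i else v s j - \<epsilon>)" for j
  let ?\<phi> = "test_function i \<theta> A (\<lambda>j. - C j) s"
  have \<phi>s: "?\<phi> s = A" by (auto simp: test_function_def fun_eq_iff)
  have "v s i - ?\<phi> s i \<le> v t j - ?\<phi> t j" if "t \<in> {0..<T}" "j \<in> states" for t j
  proof (cases "j = i")
    case True
    then show ?thesis using min[OF that(1)] by (simp add: test_function_def)
  next
    case False
    have "v s j - v t j \<le> \<epsilon> + C j * (t - s)\<^sup>2" using C[OF that(2), of t] that by auto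
    then show ?thesis using False by (simp add: test_function_def A_def)
  qed
  with test_function_C1[OF \<theta>, where T = T and i = i and A = A and C = "\<lambda>j. - C j" and r = s] super s i
  have "HJB_lhs U q f ?\<phi> (\<lambda>t j. if j = i then \<theta>' t else - C j * (2 * (t - s))) s i \<ge> 0"
    unfolding viscosity_supersolution_def by blast
  then have "hamiltonian U q f A s i \<le> - \<theta>' s"
    by (simp add: HJB_lhs_def hamiltonian_def \<phi>s)
  moreover have "hamiltonian U q f (v s) s i \<le> hamiltonian U q f A s i + \<epsilon> * (card (nbrs i) * \<bar>M\<bar>)"
    by (rule hamiltonian_perturb) (use s i eps in \<open>auto simp: A_def\<close>)
  ultimately show "hamiltonian U q f (v s) s i \<le> - \<theta>' s + \<epsilon> * (card (nbrs i) * \<bar>M\<bar>)"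
    by linarith
qed simp

lemma subsolution_right_increment:
  assumes sub: "viscosity_subsolution T U q f g v" and i: "i \<in> states" and t0: "t0 \<in> {0..<T}"
    and c: "hamiltonian U q f (v t0) t0 i < c"
  shows "\<forall>\<^sub>F b in at_right t0. v b i \<ge> v t0 i - c * (b - t0)"
proof -
  have cont: "continuous_on {0..T} (\<lambda>t. v t j)" if "j \<in> states" for j
    using sub that continuous_time_stateD unfolding viscosity_subsolution_def by blast
  show ?thesis
    using subsolution_scalar[OF sub i]
    by (intro viscosity_right_increment[OF cont[OF i] t0 hamiltonian_continuous[of v, OF cont i t0] c]) blast+
qed

text \<open>Changing the sign of the solution, the Hamiltonian, the slope and the test function
  turns a minimum into a maximum, so the scalar increment bound applies again.\<close>

lemma supersolution_right_increment:
  assumes super: "viscosity_supersolution T U q f g v" and i: "i \<in> states" and t0: "t0 \<in> {0..<T}"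
    and c: "c < hamiltonian U q f (v t0) t0 i"
  shows "\<forall>\<^sub>F b in at_right t0. v b i \<le> v t0 i - c * (b - t0)"
proof -
  have cont: "continuous_on {0..T} (\<lambda>t. v t j)" if "j \<in> states" for j
    using super that continuous_time_stateD unfolding viscosity_supersolution_def by blast
  have "\<forall>\<^sub>F b in at_right t0. - v b i \<ge> - v t0 i - (- c) * (b - t0)"
  proof (rule viscosity_right_increment[where h = "\<lambda>t. - hamiltonian U q f (v t) t i" and T = T])
    show "continuous_on {0..T} (\<lambda>b. - v b i)" by (intro continuous_intros cont i)
    show "continuous (at t0 within {0..<T}) (\<lambda>t. - hamiltonian U q f (v t) t i)"
      by (intro continuous_minus hamiltonian_continuous cont i t0)
    fix \<theta> \<theta>' :: "real \<Rightarrow> real" and s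
    assume \<theta>: "\<And>t. (\<theta> has_real_derivative \<theta>' t) (at t)" "continuous_on UNIV \<theta>'"
      and s: "s \<in> {0..<T}" and max: "\<And>t. t \<in> {0..<T} \<Longrightarrow> - v t i - \<theta> t \<le> - v s i - \<theta> s"
    have "hamiltonian U q f (v s) s i \<le> - (- \<theta>' s)"
    proof (rule supersolution_scalar[OF super i s, of "\<lambda>t. - \<theta> t" "\<lambda>t. - \<theta>' t"])
      show "((\<lambda>t. - \<theta> t) has_real_derivative - \<theta>' t) (at t)" for t by (intro DERIV_minus \<theta>(1))
      show "continuous_on UNIV (\<lambda>t. - \<theta>' t)" by (intro continuous_intros \<theta>(2))
      show "v s i - - \<theta> s \<le> v t i - - \<theta> t" if "t \<in> {0..<T}" for t using max[OF that] by simp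
    qed
    then show "- \<theta>' s \<le> - hamiltonian U q f (v s) s i" by simp
  qed (use t0 c in auto)
  then show ?thesis by (rule eventually_mono) simp
qed

section \<open>The comparison principle\<close>

lemma comparison:
  assumes super: "viscosity_supersolution T U q f g V1" and sub: "viscosity_subsolution T U q f g V2"
    and bound: "\<And>t i. t \<in> {0..T} \<Longrightarrow> i \<in> states \<Longrightarrow> V2 t i - V1 t i \<le> L"
    and Phi_ge_1: "\<And>i. i \<in> states \<Longrightarrow> \<Phi> i \<ge> 1"
    and Phi_compact: "\<And>c. finite {i \<in> states. \<Phi> i \<le> c}"
    and lyapunov: "\<And>i \<mu>. i \<in> states \<Longrightarrow> \<mu> \<in> prob_on U \<Longrightarrow> generator q \<mu> \<Phi> i \<le> \<Lambda> * \<Phi> i"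
    and Lam: "\<Lambda> \<ge> 0" and t1: "t1 \<in> {0..T}" and i1: "i1 \<in> states"
  shows "V2 t1 i1 \<le> V1 t1 i1"
proof (rule ccontr)
  define D where "D t i = V2 t i - V1 t i" for t i
  assume "\<not> ?thesis"
  then have D1: "D t1 i1 > 0" by (simp add: D_def)
  \<comment> \<open>The exponent exceeds the Lyapunov constant \<Lambda> by 1; this surplus decides
    the final contradiction.\<close>
  define E where "E t = exp ((\<Lambda> + 1) * (T - t))" for t
  have E_ge_1: "E t \<ge> 1" if "t \<in> {0..T}" for t using that Lam by (simp add: E_def)
  have E_pos: "E t > 0" for t by (simp add: E_def)
  have Phi_pos: "\<Phi> i > 0" if "i \<in> states" for i using Phi_ge_1[OF that] by simp
  \<comment> \<open>The penalty takes away exactly half of \<open>D t1 i1\<close>, so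
    \<open>W\<close> stays positive there.\<close>
  define \<delta> where "\<delta> = D t1 i1 / (2 * E t1 * \<Phi> i1)"
  have del: "\<delta> > 0" using D1 E_pos Phi_pos[OF i1] by (simp add: \<delta>_def)
  define W where "W t i = D t i - \<delta> * E t * \<Phi> i" for t i
  have W1: "W t1 i1 > 0"
    using D1 E_pos[of t1] Phi_pos[OF i1] by (simp add: W_def \<delta>_def)
  have contD: "continuous_on {0..T} (\<lambda>t. D t i)" if "i \<in> states" for i
    using super sub that continuous_time_stateD
    unfolding viscosity_supersolution_def viscosity_subsolution_def D_def
    by (intro continuous_intros) blast+
  \<comment> \<open>Since \<open>E\<close> is at least 1 on [0,T] and \<open>D\<close> is at most
    \<open>L\<close>, a state at which \<open>W\<close> is ever positive lies in this finite
    set.\<close>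
  define F where "F = {i \<in> states. \<Phi> i \<le> L / \<delta>}"
  have F_if: "i \<in> F" if "t \<in> {0..T}" "i \<in> states" "W t i > 0" for t i
  proof -
    have "\<delta> * 1 * \<Phi> i \<le> \<delta> * E t * \<Phi> i"
      using del E_ge_1[OF that(1)] Phi_pos[OF that(2)] by (intro mult_right_mono mult_left_mono) auto
    also have "\<dots> \<le> L" using that bound[OF that(1,2)] by (simp add: W_def D_def)
    finally show ?thesis using del that by (simp add: F_def field_simps)
  qed
  \<comment> \<open>The maximum is taken first over time for each state of \<open>F\<close>, then
    over the finitely many states.\<close>
  have "\<exists>s\<in>{0..T}. \<forall>t\<in>{0..T}. W t i \<le> W s i" if "i \<in> F" for i
  proof (rule continuous_attains_sup[OF compact_Icc])
    show "{0..T} \<noteq> {}" using t1 by auto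
    show "continuous_on {0..T} (\<lambda>t. W t i)"
      unfolding W_def E_def using that by (intro continuous_intros contD) (auto simp: F_def)
  qed
  then have "\<forall>i\<in>F. \<exists>s. s \<in> {0..T} \<and> (\<forall>t\<in>{0..T}. W t i \<le> W s i)" by blast
  from bchoice[OF this] obtain s where s: "\<And>i. i \<in> F \<Longrightarrow> s i \<in> {0..T}"
    and smax: "\<And>i t. i \<in> F \<Longrightarrow> t \<in> {0..T} \<Longrightarrow> W t i \<le> W (s i) i" by blast
  have i1F: "i1 \<in> F" using F_if[OF t1 i1 W1] .
  have "finite F" using Phi_compact by (simp add: F_def)
  then have "Max ((\<lambda>i. W (s i) i) ` F) \<in> (\<lambda>i. W (s i) i) ` F"
    using i1F by (intro Max_in) auto
  then obtain i0 where i0: "i0 \<in> F" and "W (s i0) i0 = Max ((\<lambda>i. W (s i) i) ` F)" by auto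
  then have i0max: "W (s i) i \<le> W (s i0) i0" if "i \<in> F" for i
    using \<open>finite F\<close> that by simp
  define t0 where "t0 = s i0"
  have i0s: "i0 \<in> states" using i0 by (simp add: F_def)
  have t0: "t0 \<in> {0..T}" using s i0 by (simp add: t0_def)
  have W0: "W t0 i0 > 0" using W1 smax[OF i1F t1] i0max[OF i1F] by (simp add: t0_def)
  have Wmax: "W t i \<le> W t0 i0" if "t \<in> {0..T}" "i \<in> states" for t i
  proof (cases "W t i > 0")
    case True
    then show ?thesis using smax[of i t] i0max[of i] F_if[OF that] that by (simp add: t0_def)
  qed (use W0 in simp)
  \<comment> \<open>The terminal values agree, so \<open>W\<close> is negative at time
    \<open>T\<close> and the maximum leaves room to its right.\<close>
  have "D T i0 = 0"
    using super sub i0s by (simp add: D_def viscosity_supersolution_def viscosity_subsolution_def)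
  then have "W T i0 < 0" using del E_pos[of T] Phi_pos[OF i0s] by (simp add: W_def)
  then have t0T: "t0 \<in> {0..<T}" using W0 t0 by (cases "t0 = T") auto
  define P where "P = \<delta> * E t0 * \<Phi> i0"
  have P: "P > 0" using del E_pos Phi_pos[OF i0s] by (simp add: P_def)
  let ?h1 = "hamiltonian U q f (V1 t0) t0 i0" and ?h2 = "hamiltonian U q f (V2 t0) t0 i0"
  \<comment> \<open>Maximality over the states at time \<open>t0\<close> bounds the increments of
    \<open>D\<close> from \<open>i0\<close> by those of the penalty; nonnegative rates and the
    Lyapunov bound turn this into \<open>\<Lambda> * P\<close>.\<close>
  have "?h2 \<le> ?h1 + \<Lambda> * P"
  proof (rule hamiltonian_mono[OF i0s t0])
    fix \<mu> assume \<mu>: "\<mu> \<in> prob_on U"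
    have "q i0 j \<mu> * (V2 t0 j - V2 t0 i0) \<le>
        q i0 j \<mu> * (V1 t0 j - V1 t0 i0) + \<delta> * E t0 * (q i0 j \<mu> * (\<Phi> j - \<Phi> i0))" if j: "j \<in> nbrs i0" for j
    proof -
      have "D t0 j - D t0 i0 \<le> \<delta> * E t0 * (\<Phi> j - \<Phi> i0)"
        using Wmax[OF t0 nbrs_states[OF j]] by (simp add: W_def algebra_simps)
      then have "q i0 j \<mu> * (D t0 j - D t0 i0) \<le> q i0 j \<mu> * (\<delta> * E t0 * (\<Phi> j - \<Phi> i0))"
        using q_bounds[OF \<mu> i0s j] by (intro mult_left_mono)
      then show ?thesis by (simp add: D_def algebra_simps)
    qed
    then have "generator q \<mu> (V2 t0) i0 \<le> generator q \<mu> (V1 t0) i0 + \<delta> * E t0 * generator q \<mu> \<Phi> i0"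
      unfolding generator_eq_sum[OF \<mu> i0s] sum_distrib_left sum.distrib[symmetric] by (rule sum_mono)
    moreover have "\<delta> * E t0 * generator q \<mu> \<Phi> i0 \<le> \<delta> * E t0 * (\<Lambda> * \<Phi> i0)"
      using lyapunov[OF i0s \<mu>] del E_pos[of t0] by (intro mult_left_mono) auto
    ultimately show "generator q \<mu> (V2 t0) i0 + f t0 i0 \<mu> \<le> generator q \<mu> (V1 t0) i0 + f t0 i0 \<mu> + \<Lambda> * P"
      by (simp add: P_def algebra_simps)
  qed
  \<comment> \<open>The increment bounds demand strict inequalities. A margin \<open>P / 4\<close>
    for each solution costs \<open>P / 2\<close> together, leaving a decay rate of \<open>D\<close>
    of at most \<open>(\<Lambda> + 1/2) * P\<close>.\<close>
  then have inc: "\<forall>\<^sub>F b in at_right t0. D b i0 \<ge> D t0 i0 - (\<Lambda> + 1/2) * P * (b - t0)"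
  proof -
    have "\<forall>\<^sub>F b in at_right t0. V2 b i0 \<ge> V2 t0 i0 - (?h2 + P / 4) * (b - t0)"
      by (rule subsolution_right_increment[OF sub i0s t0T]) (use P in auto)
    moreover have "\<forall>\<^sub>F b in at_right t0. V1 b i0 \<le> V1 t0 i0 - (?h1 - P / 4) * (b - t0)"
      by (rule supersolution_right_increment[OF super i0s t0T]) (use P in auto)
    moreover have "\<forall>\<^sub>F b in at_right t0. b > t0" by (rule eventually_at_right_less)
    ultimately show ?thesis
    proof eventually_elim
      case (elim b)
      have "(?h2 + P / 4) - (?h1 - P / 4) \<le> (\<Lambda> + 1/2) * P"
        using \<open>?h2 \<le> ?h1 + \<Lambda> * P\<close> by (simp add: algebra_simps)
      then have "((?h2 + P / 4) - (?h1 - P / 4)) * (b - t0) \<le> (\<Lambda> + 1/2) * P * (b - t0)"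
        using elim by (intro mult_right_mono) auto
      then show ?case using elim by (simp add: D_def algebra_simps)
    qed
  qed
  \<comment> \<open>The penalty itself decays at rate \<open>(\<Lambda> + 1) * P\<close>, strictly
    faster than \<open>D\<close> can, so \<open>W\<close> would increase just after its
    maximum.\<close>
  have "((\<lambda>t. \<delta> * E t * \<Phi> i0) has_real_derivative - (\<Lambda> + 1) * P) (at_right t0)"
    unfolding E_def P_def by (auto intro!: derivative_eq_intros)
  then have "((\<lambda>b. (\<delta> * E b * \<Phi> i0 - P) / (b - t0)) \<longlongrightarrow> - (\<Lambda> + 1) * P) (at_right t0)"
    by (simp add: has_field_derivative_iff P_def)
  then have "\<forall>\<^sub>F b in at_right t0. (\<delta> * E b * \<Phi> i0 - P) / (b - t0) < - (\<Lambda> + 1/2) * P"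
    by (rule order_tendstoD) (use P in \<open>auto simp: algebra_simps\<close>)
  moreover have "\<forall>\<^sub>F b in at_right t0. b \<in> {t0<..<T}"
    using t0T by (intro eventually_at_right_real) auto
  ultimately have "\<forall>\<^sub>F b in at_right t0. False"
    using inc
  proof eventually_elim
    case (elim b)
    then have "\<delta> * E b * \<Phi> i0 - P < - (\<Lambda> + 1/2) * P * (b - t0)"
      by (simp add: divide_simps)
    then have "\<delta> * E b * \<Phi> i0 - P < - ((\<Lambda> + 1/2) * P * (b - t0))"
      by (simp only: mult_minus_left)
    moreover have "D b i0 - D t0 i0 \<le> \<delta> * E b * \<Phi> i0 - P"
      using Wmax[of b i0] elim t0 i0s by (simp add: W_def P_def)
    ultimately show ?case using elim by linarith
  qed
  then show False by simp
qed

end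

section \<open>From the pointwise comparison to the suprema\<close>

theorem theorem4p5:
  fixes T :: real
    and U :: "(real ^ 'k) set"
    and q :: "nat \<Rightarrow> nat \<Rightarrow> (real ^ 'k) measure \<Rightarrow> real"
    and f :: "real \<Rightarrow> nat \<Rightarrow> (real ^ 'k) measure \<Rightarrow> real"
    and g :: "nat \<Rightarrow> real"
    and \<Phi> :: "nat \<Rightarrow> real"
    and B0 :: "nat set"
    and lam0 kap0 C0 :: real
    and K :: nat
    and V1 V2 :: "real \<Rightarrow> nat \<Rightarrow> real"
  assumes T_pos: "T > 0"
    and U_compact: "compact U"
    and U_nonempty: "U \<noteq> {}"
    and q_conservative: "conservative_rates U q"
    and f_nonneg: "\<forall>t\<in>{0..T}. \<forall>i\<in>states. \<forall>\<mu>\<in>prob_on U. f t i \<mu> \<ge> 0"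
    and f_lsc: "lower_semicontinuous
        (prod_topology (top_of_set {0..T}) (prod_topology (discrete_topology states) (W1_topology U)))
        (\<lambda>(t, i, \<mu>). f t i \<mu>)"
    and g_nonneg: "\<forall>i\<in>states. g i \<ge> 0"
    and g_lsc: "lower_semicontinuous (discrete_topology states) g"
    and q_continuous: "\<forall>i\<in>states. \<forall>j\<in>states. continuous_map (W1_topology U) euclideanreal (q i j)"
    and q_bounded: "bdd_above ((\<lambda>(i, \<mu>). - q i i \<mu>) ` (states \<times> prob_on U))"
    and Phi_ge_1: "\<forall>i\<in>states. \<Phi> i \<ge> 1"
    and Phi_compact: "\<forall>c. compactin (discrete_topology states) {i \<in> states. \<Phi> i \<le> c}"
    and B0_compact: "compactin (discrete_topology states) B0"
    and lam0_pos: "lam0 > 0"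
    and kap0_nonneg: "kap0 \<ge> 0"
    and lyapunov: "\<forall>i\<in>states. \<forall>\<mu>\<in>prob_on U.
        generator q \<mu> \<Phi> i \<le> lam0 * \<Phi> i + kap0 * indicator B0 i"
    and finite_range: "\<forall>i\<in>states. \<forall>j\<in>states. \<forall>\<mu>\<in>prob_on U.
        \<bar>int j - int i\<bar> > int K \<longrightarrow> q i j \<mu> = 0"
    and f_bounded: "bounded ((\<lambda>(t, i, \<mu>). f t i \<mu>) ` ({0..T} \<times> states \<times> prob_on U))"
    and g_bounded: "bounded (g ` states)"
    and f_lipschitz: "\<forall>s\<in>{0..T}. \<forall>t\<in>{0..T}. \<forall>i\<in>states. \<forall>\<mu>\<in>prob_on U.
        \<bar>f t i \<mu> - f s i \<mu>\<bar> \<le> C0 * \<bar>t - s\<bar>"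
    and V1_super: "viscosity_supersolution T U q f g V1"
    and V2_sub: "viscosity_subsolution T U q f g V2"
    and sup_finite: "bdd_above ((\<lambda>(t, i). V2 t i - V1 t i) ` ({0..T} \<times> states))"
  shows "(SUP (t, i)\<in>{0..T} \<times> states. V2 t i - V1 t i) = (SUP (t, i)\<in>{T} \<times> states. V2 t i - V1 t i)
    \<and> (SUP (t, i)\<in>{T} \<times> states. V2 t i - V1 t i) = 0"
proof -
  obtain M where M: "\<And>x. x \<in> (\<lambda>(i, \<mu>). - q i i \<mu>) ` (states \<times> prob_on U) \<Longrightarrow> x \<le> M"
    using q_bounded unfolding bdd_above_def by blast
  interpret finite_range_control T U q f M C0 K
  proof
    show "- q i i \<mu> \<le> M" if "i \<in> states" "\<mu> \<in> prob_on U" for i \<mu>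
      using that by (intro M) (auto intro!: rev_image_eqI[of "(i, \<mu>)"])
  qed (use U_nonempty q_conservative f_nonneg finite_range f_lipschitz in auto)
  obtain L where L: "\<And>x. x \<in> (\<lambda>(t, i). V2 t i - V1 t i) ` ({0..T} \<times> states) \<Longrightarrow> x \<le> L"
    using sup_finite unfolding bdd_above_def by blast
  have le: "V2 t i \<le> V1 t i" if t: "t \<in> {0..T}" and i: "i \<in> states" for t i
  proof (rule comparison[OF V1_super V2_sub, where L = L and \<Phi> = \<Phi> and \<Lambda> = "lam0 + kap0"])
    show "V2 t i - V1 t i \<le> L" if "t \<in> {0..T}" "i \<in> states" for t i
      using that by (intro L) (auto intro!: rev_image_eqI[of "(t, i)"])
    show "finite {i \<in> states. \<Phi> i \<le> c}" for c
      using Phi_compact[rule_format, of c] by (simp add: compactin_discrete_topology)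
    show "generator q \<mu> \<Phi> i \<le> (lam0 + kap0) * \<Phi> i" if "i \<in> states" "\<mu> \<in> prob_on U" for i \<mu>
    proof -
      \<comment> \<open>The indicator is at most 1 and hence at most \<Phi>, which merges the two
        terms of the drift condition into one multiple of \<Phi>.\<close>
      have "kap0 * indicator B0 i \<le> kap0 * \<Phi> i"
        using kap0_nonneg Phi_ge_1 that by (intro mult_left_mono) (auto simp: indicator_def intro: order_trans[of 0 1])
      moreover have "generator q \<mu> \<Phi> i \<le> lam0 * \<Phi> i + kap0 * indicator B0 i"
        using lyapunov that by blast
      ultimately show ?thesis by (simp add: distrib_right)
    qed
  qed (use Phi_ge_1 lam0_pos kap0_nonneg t i in auto)
  have eq: "V2 T i - V1 T i = 0" if "i \<in> states" for i
    using V1_super V2_sub that by (simp add: viscosity_supersolution_def viscosity_subsolution_def)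
  have one: "1 \<in> states" by (simp add: states_def)
  have "(SUP (t, i)\<in>{T} \<times> states. V2 t i - V1 t i) = 0"
    by (rule cSup_eq_maximum) (use eq one in \<open>force+\<close>)
  \<comment> \<open>The value 0 is attained at time \<open>T\<close> in state 1, and comparison
    makes it an upper bound.\<close>
  moreover have "(SUP (t, i)\<in>{0..T} \<times> states. V2 t i - V1 t i) = 0"
    by (rule cSup_eq_maximum) (use eq[OF one] one T_pos le in \<open>force+\<close>)
  ultimately show ?thesis by simp
qed

end
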